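(* Every left-cut-percolating bigraph is induced-Sidorenko.
   Context: A bigraph is a triple $G=(V_1,V_2,E)$ with $V_1,V_2$ disjoint finite sets and $E\subseteq V_1\times V_2$; write $V_i(G)=V_i$, $E(G)=E$, $e(G)=|E|$, $V(G)=V_1\cup V_2$. An automorphism of $G$ is a bijection of $V(G)$ preserving $V_1(G)$, $V_2(G)$, edges and non-edges. For $U\subseteq V(G)$, $G|_U$ is the induced subgraph (with parts $V_i(G)\cap U$) and $G-U=G|_{V(G)\setminus U}$. Folds. A cut-involution of $G$ is an automorphism $\phi$ of $G$ with $\phi=\phi^{-1}$ such that, with $\mathrm{Fix}(\phi)$ the set of vertices fixed by $\phi$, the bigraph $G-\mathrm{Fix}(\phi)$ is disconnected. A fold of $G$ is a pair $(\phi,L)$ where $\phi$ is a cut-involution of $G$ and $L\subseteq V(G)$ is such that $G|_L$ is a union of connected components of $G-\mathrm{Fix}(\phi)$ and $(L,\mathrm{Fix}(\phi),\phi(L))$ is a partition of $V(G)$. Its left-folding map $\phi_L: V(G)\to V(G)$ is $\phi_L(v)=\phi(v)$ if $v\notin L$ and $\phi_L(v)=v$ if $v\in L$. A bigraph $G$ is left-cut-percolating if there are $m\geq 0$ and sets $U_0,U_1,\ldots,U_m\subseteq V_1(G)$ with $|U_0|=1$, $U_m=V_1(G)$ and, for every $i\in\{1,\ldots,m\}$, a fold $(\phi_i,L_i)$ of $G$ with $U_i=(\phi_i)_{L_i}^{-1}(U_{i-1})$. Bigraphons. Given probability spaces $\Omega=(X,\mu)$ and $\Lambda=(Y,\nu)$,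 a bigraphon over $\Omega$ and $\Lambda$ is a bounded measurable function $W:X\times Y\to\mathbb{R}_+=[0,\infty)$. The density of $G$ in $W$ is $$t(G,W)=\int_{X^{V_1(G)}\times Y^{V_2(G)}}\prod_{(v,w)\in E(G)}W(x_v,y_w)\,d(\mu\otimes\nu)(x,y)$$ (product measures). $\rho$ denotes the edge bigraph $(\{1\},\{2\},\{(1,2)\})$, so $t(\rho,W)=\int W$. $W$ is biregular if $\int_Y W(x,y')\,d\nu(y')=t(\rho,W)$ for almost every $x\in X$ and $\int_X W(x',y)\,d\mu(x')=t(\rho,W)$ for almost every $y\in Y$. $W$ is non-zero if it is not a.e. zero. A bigraph $G_1$ weakly dominates a bigraph $G_2$ if $\frac{t(G_1,W)}{t(\rho,W)^{e(G_1)}}\geq\frac{t(G_2,W)}{t(\rho,W)^{e(G_2)}}$ for every biregular non-zero bigraphon $W$ (over any probability spaces). A bigraph is induced-Sidorenko if it weakly dominates all of its induced subgraphs. *)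

theory Defs
  imports "HOL-Probability.Probability"
begin

section \<open>Bigraphs\<close>

record 'v bigraph =
  lverts :: "'v set"
  rverts :: "'v set"
  edges :: "('v \<times> 'v) set"

definition is_bigraph :: "'v bigraph \<Rightarrow> bool" where
  "is_bigraph G \<longleftrightarrow> finite (lverts G) \<and> finite (rverts G) \<and> lverts G \<inter> rverts G = {} \<and>
     edges G \<subseteq> lverts G \<times> rverts G"

definition verts :: "'v bigraph \<Rightarrow> 'v set" where
  "verts G = lverts G \<union> rverts G"

definition induced :: "'v bigraph \<Rightarrow> 'v set \<Rightarrow> 'v bigraph" where
  "induced G U = \<lparr>lverts = lverts G \<inter> U, rverts = rverts G \<inter> U, edges = edges G \<inter> U \<times> U\<rparr>"

definition remove_verts :: "'v bigraph \<Rightarrow> 'v set \<Rightarrow> 'v bigraph" where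
  "remove_verts G U = induced G (verts G - U)"

definition edge_bigraph :: "nat bigraph" where
  "edge_bigraph = \<lparr>lverts = {1}, rverts = {2}, edges = {(1, 2)}\<rparr>"

text \<open>Edges are stored oriented from left to right, whereas paths may traverse them in both
  directions. A component is represented by its vertex set.\<close>

definition linked :: "'v bigraph \<Rightarrow> ('v \<times> 'v) set" where
  "linked G = {(u, v). u \<in> verts G \<and> v \<in> verts G \<and> (u, v) \<in> (edges G \<union> (edges G)\<inverse>)\<^sup>*}"

definition components :: "'v bigraph \<Rightarrow> 'v set set" where
  "components G = verts G // linked G"

definition disconnected :: "'v bigraph \<Rightarrow> bool" where
  "disconnected G \<longleftrightarrow> (\<exists>C\<in>components G. \<exists>D\<in>components G. C \<noteq> D)"

section \<open>Folds and left-cut-percolation\<close>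

text \<open>Maps between vertices are total functions on the vertex type; only their values on
  \<^term>\<open>verts G\<close> matter.\<close>

definition automorphism :: "'v bigraph \<Rightarrow> ('v \<Rightarrow> 'v) \<Rightarrow> bool" where
  "automorphism G \<phi> \<longleftrightarrow> bij_betw \<phi> (verts G) (verts G) \<and>
     \<phi> ` lverts G = lverts G \<and> \<phi> ` rverts G = rverts G \<and>
     (\<forall>v\<in>lverts G. \<forall>w\<in>rverts G. (\<phi> v, \<phi> w) \<in> edges G \<longleftrightarrow> (v, w) \<in> edges G)"

definition fixed_verts :: "'v bigraph \<Rightarrow> ('v \<Rightarrow> 'v) \<Rightarrow> 'v set" where
  "fixed_verts G \<phi> = {v \<in> verts G. \<phi> v = v}"

definition cut_involution :: "'v bigraph \<Rightarrow> ('v \<Rightarrow> 'v) \<Rightarrow> bool" where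
  "cut_involution G \<phi> \<longleftrightarrow> automorphism G \<phi> \<and> (\<forall>v\<in>verts G. \<phi> (\<phi> v) = v) \<and>
     disconnected (remove_verts G (fixed_verts G \<phi>))"

definition is_fold :: "'v bigraph \<Rightarrow> ('v \<Rightarrow> 'v) \<Rightarrow> 'v set \<Rightarrow> bool" where
  "is_fold G \<phi> L \<longleftrightarrow> cut_involution G \<phi> \<and> L \<subseteq> verts G \<and>
     (\<exists>\<C> \<subseteq> components (remove_verts G (fixed_verts G \<phi>)). L = \<Union>\<C>) \<and>
     L \<union> fixed_verts G \<phi> \<union> \<phi> ` L = verts G \<and>
     L \<inter> fixed_verts G \<phi> = {} \<and> L \<inter> \<phi> ` L = {} \<and> fixed_verts G \<phi> \<inter> \<phi> ` L = {}"

definition left_folding_map :: "('v \<Rightarrow> 'v) \<Rightarrow> 'v set \<Rightarrow> 'v \<Rightarrow> 'v" where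
  "left_folding_map \<phi> L v = (if v \<in> L then v else \<phi> v)"

definition left_cut_percolating :: "'v bigraph \<Rightarrow> bool" where
  "left_cut_percolating G \<longleftrightarrow>
     (\<exists>(m::nat) (U :: nat \<Rightarrow> 'v set).
        (\<forall>i\<in>{0..m}. U i \<subseteq> lverts G) \<and> card (U 0) = 1 \<and> U m = lverts G \<and>
        (\<forall>i\<in>{1..m}. \<exists>\<phi> L. is_fold G \<phi> L \<and>
           U i = {v \<in> verts G. left_folding_map \<phi> L v \<in> U (i - 1)}))"

section \<open>Bigraphons and densities\<close>

definition bigraphon :: "'a measure \<Rightarrow> 'b measure \<Rightarrow> ('a \<Rightarrow> 'b \<Rightarrow> real) \<Rightarrow> bool" where
  "bigraphon M N W \<longleftrightarrow> prob_space M \<and> prob_space N \<and>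
     case_prod W \<in> borel_measurable (M \<Otimes>\<^sub>M N) \<and>
     (\<forall>x\<in>space M. \<forall>y\<in>space N. 0 \<le> W x y) \<and>
     (\<exists>B. \<forall>x\<in>space M. \<forall>y\<in>space N. W x y \<le> B)"

definition density_in ::
    "'v bigraph \<Rightarrow> 'a measure \<Rightarrow> 'b measure \<Rightarrow> ('a \<Rightarrow> 'b \<Rightarrow> real) \<Rightarrow> real" where
  "density_in G M N W =
     (\<integral>p. (\<Prod>(v, w)\<in>edges G. W (fst p v) (snd p w))
        \<partial>(PiM (lverts G) (\<lambda>_. M) \<Otimes>\<^sub>M PiM (rverts G) (\<lambda>_. N)))"

definition biregular :: "'a measure \<Rightarrow> 'b measure \<Rightarrow> ('a \<Rightarrow> 'b \<Rightarrow> real) \<Rightarrow> bool" where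
  "biregular M N W \<longleftrightarrow>
     (AE x in M. (\<integral>y'. W x y' \<partial>N) = density_in edge_bigraph M N W) \<and>
     (AE y in N. (\<integral>x'. W x' y \<partial>M) = density_in edge_bigraph M N W)"

definition nonzero :: "'a measure \<Rightarrow> 'b measure \<Rightarrow> ('a \<Rightarrow> 'b \<Rightarrow> real) \<Rightarrow> bool" where
  "nonzero M N W \<longleftrightarrow> \<not> (AE p in M \<Otimes>\<^sub>M N. W (fst p) (snd p) = 0)"

text \<open>HOL cannot quantify over types inside a definition, so the types carrying the probability
  spaces are explicit parameters. A theorem concluding
  \<open>induced_sidorenko TYPE('a) TYPE('b) G\<close> with \<open>'a\<close>, \<open>'b\<close> otherwise unconstrained covers
  all probability spaces.\<close>

definition weakly_dominates ::
    "'a itself \<Rightarrow> 'b itself \<Rightarrow> 'v bigraph \<Rightarrow> 'w bigraph \<Rightarrow> bool" where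
  "weakly_dominates _ _ G\<^sub>1 G\<^sub>2 \<longleftrightarrow>
     (\<forall>(M :: 'a measure) (N :: 'b measure) W.
        bigraphon M N W \<and> biregular M N W \<and> nonzero M N W \<longrightarrow>
        density_in G\<^sub>1 M N W / density_in edge_bigraph M N W ^ card (edges G\<^sub>1)
          \<ge> density_in G\<^sub>2 M N W / density_in edge_bigraph M N W ^ card (edges G\<^sub>2))"

definition induced_sidorenko :: "'a itself \<Rightarrow> 'b itself \<Rightarrow> 'v bigraph \<Rightarrow> bool" where
  "induced_sidorenko A B G \<longleftrightarrow> (\<forall>U \<subseteq> verts G. weakly_dominates A B G (induced G U))"

end

theory Submission imports Defs begin

text \<open>
  Both coordinates are attached to every vertex, so that a bigraphon becomes a kernel on a single
  probability space. A fold gives, by the inequality \<open>2bc \<le> b\<^sup>2 + c\<^sup>2\<close> applied to the two conditionally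
  independent halves, that the density of an edge set is at most the mean of the densities of
  its pullbacks along the two folding maps. Edge sets are encoded by vertex colourings, on which
  pullback is composition. For a colouring of maximal density both pullbacks are again maximal, so
  a colour of one left vertex can be carried to the root \<open>u\<close> of the percolating sequence and then
  spread to all left vertices.

  Left colour 2 keeps all edges at the vertex, left colour 1 keeps the edges to right vertices of
  colour 1, and every other left colour keeps none. Spreading 2 gives all of \<open>G\<close>. Spreading 1 gives
  all left vertices and some right vertices; recolouring \<open>u\<close> by 2 then only adds pendant edges,
  which by biregularity do not change the density, and spreading 2 reaches \<open>G\<close> again. Hence \<open>G\<close> has
  maximal density among all colourings, and induced subgraphs are colourings.
\<close>

subsection \<open>Folds and percolation\<close>

text \<open>Connected components enter a fold only through a local condition: no edge joins a vertex
  of \<open>L\<close> to a moved vertex outside \<open>L\<close>. In this form \<open>L\<close> and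
  its image under \<open>\<phi>\<close> play symmetric roles.\<close>

definition reflects :: "'v set \<Rightarrow> ('v \<times> 'v) set \<Rightarrow> ('v \<Rightarrow> 'v) \<Rightarrow> 'v set \<Rightarrow> bool" where
  "reflects V E \<phi> L \<longleftrightarrow>
     (\<forall>v\<in>V. \<phi> v \<in> V \<and> \<phi> (\<phi> v) = v) \<and> L \<subseteq> V \<and> (\<forall>v\<in>L. \<phi> v \<noteq> v) \<and>
     (\<forall>v\<in>V. \<phi> v \<noteq> v \<longrightarrow> (v \<in> L \<longleftrightarrow> \<phi> v \<notin> L)) \<and>
     (\<forall>(v, w)\<in>E. (\<phi> v, \<phi> w) \<in> E) \<and>
     (\<forall>(v, w)\<in>E. (v \<in> L \<longrightarrow> w \<in> L \<or> \<phi> w = w) \<and> (w \<in> L \<longrightarrow> v \<in> L \<or> \<phi> v = v))"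

text \<open>A fold has two folding maps, the second being the left-folding map of the image of
  \<open>L\<close>. Since \<open>\<phi>\<close> maps edges to edges, each condition for the image at
  \<open>v\<close> is the condition for \<open>L\<close> at \<open>\<phi> v\<close>, so whatever is
  shown for one half holds for the other.\<close>

lemma reflects_swap:
  assumes "reflects V E \<phi> L" "E \<subseteq> V \<times> V"
  shows "reflects V E \<phi> (\<phi> ` L)"
proof -
  have V: "\<phi> v \<in> V" "\<phi> (\<phi> v) = v" if "v \<in> V" for v
    using assms(1) that unfolding reflects_def by auto
  have LV: "L \<subseteq> V" and L: "\<And>v. v \<in> L \<Longrightarrow> \<phi> v \<noteq> v"
    and part: "\<And>v. v \<in> V \<Longrightarrow> \<phi> v \<noteq> v \<Longrightarrow> v \<in> L \<longleftrightarrow> \<phi> v \<notin> L"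
    and E: "\<And>v w. (v, w) \<in> E \<Longrightarrow> (\<phi> v, \<phi> w) \<in> E"
    and cross: "\<And>v w. (v, w) \<in> E \<Longrightarrow>
      (v \<in> L \<longrightarrow> w \<in> L \<or> \<phi> w = w) \<and> (w \<in> L \<longrightarrow> v \<in> L \<or> \<phi> v = v)"
    using assms(1) unfolding reflects_def by blast+
  have mem: "v \<in> \<phi> ` L \<longleftrightarrow> \<phi> v \<in> L" if "v \<in> V" for v
    using V LV that by (metis image_iff subsetD)
  have 1: "\<phi> ` L \<subseteq> V" using LV V by auto
  have 2: "\<phi> v \<noteq> v" if "v \<in> \<phi> ` L" for v
    using that L LV V(2) by force
  have 3: "v \<in> \<phi> ` L \<longleftrightarrow> \<phi> v \<notin> \<phi> ` L" if "v \<in> V" "\<phi> v \<noteq> v" for v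
    using mem[of v] mem[of "\<phi> v"] V[of v] part[of v] that by auto
  have 4: "(v \<in> \<phi> ` L \<longrightarrow> w \<in> \<phi> ` L \<or> \<phi> w = w) \<and> (w \<in> \<phi> ` L \<longrightarrow> v \<in> \<phi> ` L \<or> \<phi> v = v)"
    if e: "(v, w) \<in> E" for v w
  proof -
    have vw: "v \<in> V" "w \<in> V" using e assms(2) by auto
    show ?thesis
      using cross[OF E[OF e]] V[OF vw(1)] V[OF vw(2)] unfolding mem[OF vw(1)] mem[OF vw(2)] by metis
  qed
  show ?thesis
    unfolding reflects_def
  proof (intro conjI)
    show "\<forall>v\<in>V. \<phi> v \<in> V \<and> \<phi> (\<phi> v) = v" using V by simp
    show "\<forall>v\<in>V. \<phi> v \<noteq> v \<longrightarrow> (v \<in> \<phi> ` L \<longleftrightarrow> \<phi> v \<notin> \<phi> ` L)" using 3 by blast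
    show "\<forall>(v, w)\<in>E. (\<phi> v, \<phi> w) \<in> E" using E by blast
  qed (use 1 2 4 in blast)+
qed

lemma linked_trans_edge:
  assumes "(r, v) \<in> linked G" "w \<in> verts G" "(v, w) \<in> edges G \<or> (w, v) \<in> edges G"
  shows "(r, w) \<in> linked G"
  using assms unfolding linked_def by (auto intro: rtrancl_into_rtrancl)

text \<open>An edge from \<open>L\<close> to a vertex moved by \<open>\<phi>\<close> survives the
  deletion of the fixed vertices, so both its ends lie in one component, and \<open>L\<close> is a
  union of components.\<close>

lemma fold_reflects:
  assumes "is_bigraph G" "is_fold G \<phi> L"
  shows "reflects (verts G) (edges G) \<phi> L"
proof -
  let ?H = "remove_verts G (fixed_verts G \<phi>)"
  have LV: "L \<subseteq> verts G" and
    part: "L \<union> fixed_verts G \<phi> \<union> \<phi> ` L = verts G" "L \<inter> fixed_verts G \<phi> = {}"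
      "L \<inter> \<phi> ` L = {}" "fixed_verts G \<phi> \<inter> \<phi> ` L = {}"
    and aut: "automorphism G \<phi>" and inv: "\<forall>v\<in>verts G. \<phi> (\<phi> v) = v"
    using assms unfolding is_fold_def cut_involution_def by auto
  obtain \<C> where C: "\<C> \<subseteq> components ?H" "L = \<Union>\<C>"
    using assms unfolding is_fold_def by auto
  have edge: "v \<in> verts G \<and> w \<in> verts G" if "(v, w) \<in> edges G" for v w
    using that assms(1) unfolding is_bigraph_def verts_def by auto
  have bip: "v \<in> lverts G \<and> w \<in> rverts G" if "(v, w) \<in> edges G" for v w
    using that assms(1) unfolding is_bigraph_def by auto
  have inV: "\<phi> v \<in> verts G" if "v \<in> verts G" for v
    using aut that unfolding automorphism_def bij_betw_def by auto
  have step: "w \<in> L" if "v \<in> L" "w \<in> verts G" "\<phi> w \<noteq> w" "(v, w) \<in> edges G \<or> (w, v) \<in> edges G"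
    for v w
  proof -
    have "v \<in> \<Union>\<C>" using C that by simp
    then obtain D where D: "D \<in> \<C>" "v \<in> D" by blast
    then obtain r where r: "D = linked ?H `` {r}"
      using C unfolding components_def by (auto elim: quotientE)
    have vH: "v \<in> verts G - fixed_verts G \<phi>" using LV part that by auto
    have wH: "w \<in> verts G - fixed_verts G \<phi>" using that by (auto simp: fixed_verts_def)
    have "(r, w) \<in> linked ?H"
    proof (rule linked_trans_edge)
      show "(r, v) \<in> linked ?H" using D r by auto
      show "w \<in> verts ?H"
        using wH unfolding remove_verts_def induced_def verts_def by auto
      show "(v, w) \<in> edges ?H \<or> (w, v) \<in> edges ?H"
        using wH vH that unfolding remove_verts_def induced_def by auto
    qed
    then show ?thesis using D r C by auto
  qed
  have e1: "(\<phi> v, \<phi> w) \<in> edges G" if "(v, w) \<in> edges G" for v w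
    using aut bip[OF that] that unfolding automorphism_def by auto
  have e2: "v \<in> L \<longleftrightarrow> \<phi> v \<notin> L" if "v \<in> verts G" "\<phi> v \<noteq> v" for v
  proof -
    have "v \<in> L \<or> v \<in> \<phi> ` L" using part(1) that by (auto simp: fixed_verts_def)
    then show ?thesis using part(3) inv LV by auto
  qed
  show ?thesis
    unfolding reflects_def
  proof (intro conjI)
    show "\<forall>v\<in>verts G. \<phi> v \<in> verts G \<and> \<phi> (\<phi> v) = v" using inV inv by simp
    show "\<forall>v\<in>L. \<phi> v \<noteq> v" using LV part(2) by (auto simp: fixed_verts_def)
    show "\<forall>v\<in>verts G. \<phi> v \<noteq> v \<longrightarrow> (v \<in> L \<longleftrightarrow> \<phi> v \<notin> L)" using e2 by blast
    show "\<forall>(v, w)\<in>edges G. (v \<in> L \<longrightarrow> w \<in> L \<or> \<phi> w = w) \<and> (w \<in> L \<longrightarrow> v \<in> L \<or> \<phi> v = v)"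
      using step edge by blast
  qed (use LV e1 in blast)+
qed

text \<open>In the application \<open>P\<close> is maximality of the density. The sequence is
  traversed twice: downwards from \<open>U m\<close>, following one vertex until its colour reaches
  the single element of \<open>U 0\<close>, then upwards, keeping the colouring constant on
  \<open>U i\<close>.\<close>

lemma percolation:
  assumes lcp: "left_cut_percolating G" and v: "v \<in> lverts G" "P c"
    and step: "\<And>c \<phi> L. P c \<Longrightarrow> is_fold G \<phi> L \<Longrightarrow>
      P (c \<circ> left_folding_map \<phi> L) \<and> P (c \<circ> left_folding_map \<phi> (\<phi> ` L))"
  obtains c' where "P c'" "\<And>w. w \<in> lverts G \<Longrightarrow> c' w = c v"
proof -
  obtain m U where U: "card (U 0) = 1" "U m = lverts G" "\<forall>i\<in>{0..m::nat}. U i \<subseteq> lverts G"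
    and ex: "\<forall>i\<in>{1..m}. \<exists>\<phi> L. is_fold G \<phi> L \<and>
      U i = {v \<in> verts G. left_folding_map \<phi> L v \<in> U (i - 1)}"
    using lcp unfolding left_cut_percolating_def by blast
  obtain u where u: "U 0 = {u}" using U(1) card_1_singletonE by blast
  have to_root: "P c \<Longrightarrow> v \<in> U i \<Longrightarrow> i \<le> m \<Longrightarrow> \<exists>c'. P c' \<and> c' u = c v" for i c v
  proof (induction i arbitrary: c v)
    case 0
    then show ?case using u by auto
  next
    case (Suc i)
    obtain \<phi> L where f: "is_fold G \<phi> L" "U (Suc i) = {v \<in> verts G. left_folding_map \<phi> L v \<in> U i}"
      using ex Suc.prems(3) by fastforce
    let ?w = "left_folding_map \<phi> L v"
    have w: "?w \<in> U i" and vV: "v \<in> verts G" using f Suc.prems by auto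
    have inv: "\<forall>v\<in>verts G. \<phi> (\<phi> v) = v" and LV: "L \<subseteq> verts G"
      and part: "L \<union> fixed_verts G \<phi> \<union> \<phi> ` L = verts G"
      "L \<inter> \<phi> ` L = {}" "fixed_verts G \<phi> \<inter> \<phi> ` L = {}"
      using f unfolding is_fold_def cut_involution_def by auto
    \<comment> \<open>One of the two folding maps undoes the passage from \<open>v\<close> to
      \<open>?w\<close>: if \<open>v\<close> is in \<open>L\<close> or fixed, then \<open>?w\<close>
      is \<open>v\<close> and the first map fixes it; otherwise \<open>?w\<close> is
      \<open>\<phi> v\<close>, which lies in \<open>L\<close>, and the second map sends it back to
      \<open>v\<close>.\<close>
    have "left_folding_map \<phi> L ?w = v \<or> left_folding_map \<phi> (\<phi> ` L) ?w = v"
      using vV inv part LV unfolding left_folding_map_def by (auto simp: fixed_verts_def)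
    then obtain c' where "P c'" "c' ?w = c v"
      using step[OF Suc.prems(1) f(1)] by (metis comp_apply)
    then show ?case using Suc.IH[OF _ w] Suc.prems by fastforce
  qed
  obtain c0 where c0: "P c0" "c0 u = c v"
    using to_root[of c v m] v U by auto
  have "i \<le> m \<Longrightarrow> \<exists>c'. P c' \<and> (\<forall>w\<in>U i. c' w = c v)" for i
  proof (induction i)
    case 0
    then show ?case using c0 u by auto
  next
    case (Suc i)
    then obtain c' where c': "P c'" "\<forall>w\<in>U i. c' w = c v" by auto
    obtain \<phi> L where f: "is_fold G \<phi> L" "U (Suc i) = {v \<in> verts G. left_folding_map \<phi> L v \<in> U i}"
      using ex Suc.prems by fastforce
    \<comment> \<open>\<open>U (Suc i)\<close> is the preimage of \<open>U i\<close> under the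
      folding map, so composing with that map makes the colouring constant on
      \<open>U (Suc i)\<close>.\<close>
    show ?case using step[OF c'(1) f(1)] c'(2) f(2) by auto
  qed
  then show ?thesis using that U by blast
qed

subsection \<open>Densities in a kernel\<close>

lemma ennreal_two_mult_le_squares: "2 * (b * c) \<le> b * b + c * (c::ennreal)"
proof (cases b; cases c)
  fix x y assume *: "b = ennreal x" "0 \<le> x" "c = ennreal y" "0 \<le> y"
  have "2 * (x * y) \<le> x * x + y * y" using sum_squares_bound[of x y] by (simp add: power2_eq_square)
  then have "ennreal (2 * (x * y)) \<le> ennreal (x * x + y * y)" by (rule ennreal_leI)
  then show ?thesis using * by (simp add: ennreal_mult ennreal_plus)
qed (auto simp: ennreal_mult_top ennreal_top_mult)

text \<open>Values in \<open>ennreal\<close> allow Tonelli's theorem without integrability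
  conditions; real densities return only at the end. With all vertices over one space, a reflection
  acts by permuting integration variables.\<close>

locale kernel = prob_space Z for Z :: "'z measure" +
  fixes k :: "'z \<Rightarrow> 'z \<Rightarrow> ennreal"
  assumes k_measurable [measurable]: "case_prod k \<in> borel_measurable (Z \<Otimes>\<^sub>M Z)"
begin

lemma prob_space_base: "prob_space Z"
  by unfold_locales

sublocale product_prob_space "\<lambda>_. Z" V for V :: "'v set"
  by standard

definition hom_density :: "'v set \<Rightarrow> ('v \<times> 'v) set \<Rightarrow> ennreal" where
  "hom_density V F = (\<integral>\<^sup>+ z. (\<Prod>(v, w)\<in>F. k (z v) (z w)) \<partial>PiM V (\<lambda>_. Z))"

definition glue :: "'v set \<Rightarrow> ('v \<Rightarrow> 'z) \<Rightarrow> ('v \<Rightarrow> 'z) \<Rightarrow> 'v \<Rightarrow> 'z" where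
  "glue X x y v = (if v \<in> X then x v else y v)"

lemma glue_measurable:
  assumes "v \<in> X \<union> D"
  shows "(\<lambda>p. glue X (fst p) (snd p) v) \<in> (PiM X (\<lambda>_. Z) \<Otimes>\<^sub>M PiM D (\<lambda>_. Z)) \<rightarrow>\<^sub>M Z"
  using assms by (cases "v \<in> X") (simp_all add: glue_def)

lemma prod_k_measurable:
  assumes "\<And>v w. (v, w) \<in> F \<Longrightarrow> f v \<in> S \<rightarrow>\<^sub>M Z" "\<And>v w. (v, w) \<in> F \<Longrightarrow> f w \<in> S \<rightarrow>\<^sub>M Z"
  shows "(\<lambda>z. \<Prod>(v, w)\<in>F. k (f v z) (f w z)) \<in> borel_measurable S"
proof (rule borel_measurable_prod_ennreal)
  fix e assume e: "e \<in> F"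
  obtain v w where vw: "e = (v, w)" by force
  have [measurable]: "f v \<in> S \<rightarrow>\<^sub>M Z" "f w \<in> S \<rightarrow>\<^sub>M Z" using assms e vw by auto
  show "(\<lambda>z. case e of (v, w) \<Rightarrow> k (f v z) (f w z)) \<in> borel_measurable S"
    unfolding vw by simp
qed

lemma hom_density_measurable:
  assumes "F \<subseteq> V \<times> V"
  shows "(\<lambda>z. \<Prod>(v, w)\<in>F. k (z v) (z w)) \<in> borel_measurable (PiM V (\<lambda>_. Z))"
  using assms by (intro prod_k_measurable) auto

text \<open>This is the conditional expectation of the edge product of \<open>F\<close> given the
  values \<open>x\<close> on \<open>X\<close>. It is applied with \<open>X\<close> the mirror of a
  fold and \<open>D\<close> one of its halves.\<close>

definition side_density :: "'v set \<Rightarrow> 'v set \<Rightarrow> ('v \<times> 'v) set \<Rightarrow> ('v \<Rightarrow> 'z) \<Rightarrow> ennreal" where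
  "side_density X D F x =
     (\<integral>\<^sup>+ y. (\<Prod>(v, w)\<in>F. k (glue X x y v) (glue X x y w)) \<partial>PiM D (\<lambda>_. Z))"

lemma side_integrand_measurable:
  assumes "F \<subseteq> (X \<union> D) \<times> (X \<union> D)"
  shows "(\<lambda>p. \<Prod>(v, w)\<in>F. k (glue X (fst p) (snd p) v) (glue X (fst p) (snd p) w))
     \<in> borel_measurable (PiM X (\<lambda>_. Z) \<Otimes>\<^sub>M PiM D (\<lambda>_. Z))"
  using assms by (intro prod_k_measurable glue_measurable) auto

lemma side_density_measurable:
  assumes "finite D" "F \<subseteq> (X \<union> D) \<times> (X \<union> D)"
  shows "side_density X D F \<in> borel_measurable (PiM X (\<lambda>_. Z))"
proof -
  have sf: "sigma_finite_measure (PiM D (\<lambda>_. Z))"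
    by (intro prob_space_imp_sigma_finite prob_space_PiM prob_space_base)
  show ?thesis
    using sigma_finite_measure.borel_measurable_nn_integral_fst[OF sf side_integrand_measurable[OF assms(2)]]
    unfolding side_density_def by simp
qed

text \<open>Once the values on \<open>X\<close> are fixed, no factor involves both \<open>L\<close>
  and \<open>R\<close>, so the integral over the remaining variables is a product of two: the halves
  are conditionally independent.\<close>

lemma hom_density_split:
  assumes fin: "finite X" "finite L" "finite R"
    and disj: "X \<inter> L = {}" "X \<inter> R = {}" "L \<inter> R = {}"
    and F: "F0 \<subseteq> X \<times> X" "FL \<subseteq> (X \<union> L) \<times> (X \<union> L)" "FR \<subseteq> (X \<union> R) \<times> (X \<union> R)"
    and Fdisj: "F0 \<inter> FL = {}" "F0 \<inter> FR = {}" "FL \<inter> FR = {}"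
  shows "hom_density (X \<union> (L \<union> R)) (F0 \<union> FL \<union> FR) =
    (\<integral>\<^sup>+ x. (\<Prod>(v, w)\<in>F0. k (x v) (x w)) * (side_density X L FL x * side_density X R FR x)
       \<partial>PiM X (\<lambda>_. Z))"
proof -
  let ?F = "F0 \<union> FL \<union> FR" and ?P = "\<lambda>I. PiM I (\<lambda>_. Z)"
  let ?f = "\<lambda>z. \<Prod>(v, w)\<in>?F. k (z v) (z w)"
  let ?g = "\<lambda>F x y. \<Prod>(v, w)\<in>F. k (glue X x y v) (glue X x y w)"
  have finF: "finite F0" "finite FL" "finite FR"
    using F fin by (auto intro: finite_subset)
  have fm: "?f \<in> borel_measurable (?P (X \<union> (L \<union> R)))"
    using F by (intro hom_density_measurable) auto
  have inner: "(\<integral>\<^sup>+ y. ?f (merge X (L \<union> R) (x, y)) \<partial>?P (L \<union> R)) =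
    (\<Prod>(v, w)\<in>F0. k (x v) (x w)) * (side_density X L FL x * side_density X R FR x)"
    if x: "x \<in> space (?P X)" for x
  proof -
    have gm: "?g F' x \<in> borel_measurable (?P D)" if "F' \<subseteq> (X \<union> D) \<times> (X \<union> D)" for F' D
      using measurable_compose[OF measurable_Pair1'[OF x] side_integrand_measurable[OF that]]
      by simp
    have m: "(\<lambda>y. ?f (merge X (L \<union> R) (x, y))) \<in> borel_measurable (?P (L \<union> R))"
      by (rule measurable_compose[OF _ fm])
        (rule measurable_compose[OF measurable_Pair1'[OF x] measurable_merge])
    have eq: "?f (merge X (L \<union> R) (x, merge L R (y1, y2))) =
        (\<Prod>(v, w)\<in>F0. k (x v) (x w)) * ?g FL x y1 * ?g FR x y2" for y1 y2
    proof -
      let ?z = "merge X (L \<union> R) (x, merge L R (y1, y2))"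
      have z: "?z v = (if v \<in> X then x v else if v \<in> L then y1 v else if v \<in> R then y2 v else undefined)"
        for v using disj by (auto simp: merge_def)
      have zL: "?z v = glue X x y1 v" if "v \<in> X \<union> L" for v
        using that disj by (auto simp: z glue_def)
      have zR: "?z v = glue X x y2 v" if "v \<in> X \<union> R" for v
        using that disj by (auto simp: z glue_def)
      have "?f ?z = (\<Prod>(v, w)\<in>F0. k (?z v) (?z w)) * (\<Prod>(v, w)\<in>FL. k (?z v) (?z w)) *
         (\<Prod>(v, w)\<in>FR. k (?z v) (?z w))"
        using finF Fdisj by (subst prod.union_disjoint; (subst prod.union_disjoint)?) auto
      moreover have "(\<Prod>(v, w)\<in>F0. k (?z v) (?z w)) = (\<Prod>(v, w)\<in>F0. k (x v) (x w))"
        using F by (intro prod.cong) (auto simp: z)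
      moreover have "(\<Prod>(v, w)\<in>FL. k (?z v) (?z w)) = ?g FL x y1"
        using F zL by (intro prod.cong refl) auto
      moreover have "(\<Prod>(v, w)\<in>FR. k (?z v) (?z w)) = ?g FR x y2"
        using F zR by (intro prod.cong refl) auto
      ultimately show ?thesis by simp
    qed
    show ?thesis
      using fin disj gm[OF F(2)] gm[OF F(3)]
      by (simp add: product_nn_integral_fold[OF disj(3) fin(2,3) m] eq nn_integral_cmult
        nn_integral_multc side_density_def mult.assoc)
  qed
  show ?thesis
    unfolding hom_density_def
    using disj fin by (subst product_nn_integral_fold[OF _ _ _ fm]) (auto intro!: nn_integral_cong inner)
qed

text \<open>Renaming variables along a bijection preserves the product measure, all factors being
  \<open>Z\<close>, and the values \<open>x\<close> are unaffected because \<open>\<phi>\<close> is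
  the identity on \<open>X\<close>. Hence a reflected side contributes the same as the original
  one.\<close>

lemma side_density_reindex:
  assumes bij: "bij_betw \<phi> D D'" and fin: "finite D'" and fixd: "\<And>v. v \<in> X \<Longrightarrow> \<phi> v = v"
    and disj: "X \<inter> D = {}" "X \<inter> D' = {}" and F: "F \<subseteq> (X \<union> D) \<times> (X \<union> D)"
    and x: "x \<in> space (PiM X (\<lambda>_. Z))"
  shows "side_density X D' (map_prod \<phi> \<phi> ` F) x = side_density X D F x"
proof -
  let ?P = "\<lambda>I. PiM I (\<lambda>_. Z)" and ?t = "\<lambda>y. \<lambda>n\<in>D. y (\<phi> n)"
  let ?g = "\<lambda>F y. \<Prod>(v, w)\<in>F. k (glue X x y v) (glue X x y w)"
  \<comment> \<open>Distinct edges must stay distinct when the product is reindexed;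
    \<open>\<phi>\<close> cannot merge a vertex of \<open>X\<close> with one of \<open>D\<close>,
    since it fixes \<open>X\<close> and maps \<open>D\<close> onto a set disjoint from it.\<close>
  have inj: "inj_on \<phi> (X \<union> D)"
    using bij fixd disj unfolding bij_betw_def inj_on_def by (metis Un_iff disjoint_iff image_eqI)
  have injF: "inj_on (map_prod \<phi> \<phi>) F"
    using map_prod_inj_on[OF inj inj] F by (rule inj_on_subset)
  have gm: "?g F \<in> borel_measurable (?P D)"
    using measurable_compose[OF measurable_Pair1'[OF x] side_integrand_measurable[OF F]] by simp
  have tm: "?t \<in> ?P D' \<rightarrow>\<^sub>M ?P D"
    using bij by (intro measurable_restrict) (auto simp: bij_betw_def)
  have d: "distr (?P D') (?P D) ?t = ?P D"
    by (rule distr_PiM_reindex) (use bij in \<open>auto simp: bij_betw_def prob_space_base\<close>)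
  have "side_density X D F x = integral\<^sup>N (distr (?P D') (?P D) ?t) (?g F)"
    by (simp add: d side_density_def)
  also have "\<dots> = (\<integral>\<^sup>+ y. ?g F (?t y) \<partial>?P D')"
    by (rule nn_integral_distr[OF tm]) (use gm in simp)
  also have "\<dots> = (\<integral>\<^sup>+ y. ?g (map_prod \<phi> \<phi> ` F) y \<partial>?P D')"
  proof (rule nn_integral_cong)
    fix y
    have g: "glue X x (?t y) v = glue X x y (\<phi> v)" if "v \<in> X \<union> D" for v
      using that fixd disj bij by (auto simp: glue_def bij_betw_def)
    show "?g F (?t y) = ?g (map_prod \<phi> \<phi> ` F) y"
      using F by (subst prod.reindex[OF injF]) (auto intro!: prod.cong simp: g subset_iff)
  qed
  finally show ?thesis by (simp add: side_density_def)
qed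

end

section \<open>The fold inequality for coloured edge sets\<close>

definition coloured_edges :: "('c \<Rightarrow> 'c \<Rightarrow> bool) \<Rightarrow> ('v \<times> 'v) set \<Rightarrow> ('v \<Rightarrow> 'c) \<Rightarrow> ('v \<times> 'v) set" where
  "coloured_edges Q E c = {(v, w) \<in> E. Q (c v) (c w)}"

lemma coloured_edges_subset: "coloured_edges Q E c \<subseteq> E"
  by (auto simp: coloured_edges_def)

context kernel begin

context
  fixes V :: "'v set" and E \<phi> L and Q :: "'c \<Rightarrow> 'c \<Rightarrow> bool"
  assumes fin: "finite V" and EV: "E \<subseteq> V \<times> V" and refl: "reflects V E \<phi> L"
begin

text \<open>The fixed vertices separate the two halves, so each coloured edge falls into exactly one
  of three classes: inside the mirror, touching \<open>L\<close>, or touching the image of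
  \<open>L\<close>.\<close>

abbreviation "mirror_verts \<equiv> {v \<in> V. \<phi> v = v}"
abbreviation "core c \<equiv> coloured_edges Q E c \<inter> mirror_verts \<times> mirror_verts"
abbreviation "side D c \<equiv> {(v, w) \<in> coloured_edges Q E c. v \<in> D \<or> w \<in> D}"
abbreviation "core_prod c x \<equiv> \<Prod>(v, w)\<in>core c. k (x v) (x w)"

lemma reflD:
  "\<And>v. v \<in> V \<Longrightarrow> \<phi> v \<in> V" "\<And>v. v \<in> V \<Longrightarrow> \<phi> (\<phi> v) = v" "L \<subseteq> V"
  "\<And>v. v \<in> L \<Longrightarrow> \<phi> v \<noteq> v" "\<And>v. v \<in> V \<Longrightarrow> \<phi> v \<noteq> v \<Longrightarrow> v \<in> L \<longleftrightarrow> \<phi> v \<notin> L"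
  "\<And>v w. (v, w) \<in> E \<Longrightarrow> (\<phi> v, \<phi> w) \<in> E"
  "\<And>v w. (v, w) \<in> E \<Longrightarrow> v \<in> L \<Longrightarrow> w \<in> L \<or> \<phi> w = w"
  "\<And>v w. (v, w) \<in> E \<Longrightarrow> w \<in> L \<Longrightarrow> v \<in> L \<or> \<phi> v = v"
  using refl unfolding reflects_def by blast+

lemma image_L: "v \<in> V \<Longrightarrow> v \<in> \<phi> ` L \<longleftrightarrow> \<phi> v \<in> L"
  using reflD(2,3) by (metis image_iff subsetD)

lemma verts_split: "mirror_verts \<union> (L \<union> \<phi> ` L) = V"
proof
  show "mirror_verts \<union> (L \<union> \<phi> ` L) \<subseteq> V" using reflD(1,3) by blast
  have "v \<in> L \<or> v \<in> \<phi> ` L" if "v \<in> V" "\<phi> v \<noteq> v" for v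
    using that reflD(5)[of v] image_L[of v] by auto
  then show "V \<subseteq> mirror_verts \<union> (L \<union> \<phi> ` L)" by blast
qed

lemma parts_disjoint:
  "L \<inter> \<phi> ` L = {}" "mirror_verts \<inter> L = {}" "mirror_verts \<inter> \<phi> ` L = {}"
proof -
  have "v \<notin> \<phi> ` L" if "v \<in> L" for v
    using that image_L[of v] reflD(3) reflD(4,5)[of v] by auto
  then show "L \<inter> \<phi> ` L = {}" by blast
  show "mirror_verts \<inter> L = {}" using reflD(4) by blast
  have "v \<notin> \<phi> ` L" if "v \<in> V" "\<phi> v = v" for v
    using that image_L[of v] reflD(4)[of v] by auto
  then show "mirror_verts \<inter> \<phi> ` L = {}" by blast
qed

lemma side_subset: "side L c \<subseteq> (mirror_verts \<union> L) \<times> (mirror_verts \<union> L)"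
  using EV reflD(7,8) unfolding coloured_edges_def by blast

lemma side_image_subset: "side (\<phi> ` L) c \<subseteq> (mirror_verts \<union> \<phi> ` L) \<times> (mirror_verts \<union> \<phi> ` L)"
proof
  fix e assume e: "e \<in> side (\<phi> ` L) c"
  obtain v w where vw: "e = (v, w)" by force
  have E: "(v, w) \<in> E" "v \<in> V" "w \<in> V" using e vw EV by (auto simp: coloured_edges_def)
  have "\<phi> v \<in> L \<or> \<phi> w \<in> L" using e vw image_L E by auto
  then show "e \<in> (mirror_verts \<union> \<phi> ` L) \<times> (mirror_verts \<union> \<phi> ` L)"
    using reflD(7,8)[OF reflD(6)[OF E(1)]] reflD(2)[OF E(2)] reflD(2)[OF E(3)] E image_L vw
    by auto
qed

lemma hom_density_fold_split:
  "hom_density V (coloured_edges Q E c) =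
    (\<integral>\<^sup>+ x. core_prod c x * (side_density mirror_verts L (side L c) x *
       side_density mirror_verts (\<phi> ` L) (side (\<phi> ` L) c) x) \<partial>PiM mirror_verts (\<lambda>_. Z))"
proof -
  have "\<phi> v = v" if "v \<in> V" "v \<notin> L" "v \<notin> \<phi> ` L" for v
    using that verts_split by blast
  then have eq: "coloured_edges Q E c = core c \<union> side L c \<union> side (\<phi> ` L) c"
    using EV unfolding coloured_edges_def by fast
  have disj: "core c \<inter> side L c = {}" "core c \<inter> side (\<phi> ` L) c = {}"
    "side L c \<inter> side (\<phi> ` L) c = {}"
  proof -
    show "core c \<inter> side L c = {}" "core c \<inter> side (\<phi> ` L) c = {}"
      using parts_disjoint by auto
    \<comment> \<open>An edge counted on both sides would have both ends in the mirror, whereas an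
      edge of \<open>side L c\<close> has an end in \<open>L\<close>.\<close>
    have "A \<inter> B \<subseteq> X \<times> X"
      if "L \<inter> R = {}" "A \<subseteq> (X \<union> L) \<times> (X \<union> L)" "B \<subseteq> (X \<union> R) \<times> (X \<union> R)" for A B X R
      using that by blast
    from this[OF parts_disjoint(1) side_subset side_image_subset]
    have "side L c \<inter> side (\<phi> ` L) c \<subseteq> mirror_verts \<times> mirror_verts" .
    moreover have "side L c \<inter> mirror_verts \<times> mirror_verts = {}"
      using parts_disjoint(2) by auto
    ultimately show "side L c \<inter> side (\<phi> ` L) c = {}" by blast
  qed
  have "hom_density (mirror_verts \<union> (L \<union> \<phi> ` L)) (core c \<union> side L c \<union> side (\<phi> ` L) c) =
    (\<integral>\<^sup>+ x. core_prod c x * (side_density mirror_verts L (side L c) x *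
       side_density mirror_verts (\<phi> ` L) (side (\<phi> ` L) c) x) \<partial>PiM mirror_verts (\<lambda>_. Z))"
  proof (rule hom_density_split)
    show "finite mirror_verts" using fin by simp
    show "finite L" using fin reflD(3) finite_subset by blast
    then show "finite (\<phi> ` L)" by simp
  qed (rule Int_lower2 side_subset side_image_subset parts_disjoint disj)+
  then show ?thesis by (simp only: eq[symmetric] verts_split)
qed

text \<open>After the pullback the right half carries the mirror image of the left colouring, and by
  \<open>side_density_reindex\<close> its conditional density equals that of the left half; hence
  the square. The mirror itself is unchanged.\<close>

lemma hom_density_folded:
  "hom_density V (coloured_edges Q E (c \<circ> left_folding_map \<phi> L)) =
    (\<integral>\<^sup>+ x. core_prod c x * (side_density mirror_verts L (side L c) x *
       side_density mirror_verts L (side L c) x) \<partial>PiM mirror_verts (\<lambda>_. Z))"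
proof -
  let ?h = "left_folding_map \<phi> L"
  have h: "?h v = v" if "v \<in> mirror_verts \<union> L" for v
    using that by (auto simp: left_folding_map_def)
  have core: "core (c \<circ> ?h) = core c"
    using h by (auto simp: coloured_edges_def)
  have sideL: "side L (c \<circ> ?h) = side L c"
  proof -
    have "(v, w) \<in> side L (c \<circ> ?h) \<longleftrightarrow> (v, w) \<in> side L c" for v w
    proof (cases "(v, w) \<in> E \<and> (v \<in> L \<or> w \<in> L)")
      case True
      then have "?h v = v" "?h w = w" using h reflD(7,8) EV by blast+
      then show ?thesis by (simp add: coloured_edges_def)
    qed (auto simp: coloured_edges_def)
    then show ?thesis by auto
  qed
  have sideR: "side (\<phi> ` L) (c \<circ> ?h) = map_prod \<phi> \<phi> ` side L c"
  proof -
    have eq: "(v, w) \<in> side (\<phi> ` L) (c \<circ> ?h) \<longleftrightarrow> (\<phi> v, \<phi> w) \<in> side L c"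
      if vw: "v \<in> V" "w \<in> V" for v w
    proof (cases "(v, w) \<in> E \<and> (\<phi> v \<in> L \<or> \<phi> w \<in> L)")
      case True
      \<comment> \<open>The edge \<open>(\<phi> v, \<phi> w)\<close> touches \<open>L\<close>, so
        each of its ends is in \<open>L\<close> or fixed. Either way the folding map agrees with
        \<open>\<phi>\<close> at \<open>v\<close> and at \<open>w\<close>.\<close>
      have hv: "?h v = \<phi> v" "?h w = \<phi> w"
        using True vw reflD(2)[OF vw(1)] reflD(2)[OF vw(2)] reflD(4,5) reflD(7,8)[OF reflD(6)[of v w]]
        unfolding left_folding_map_def by metis+
      show ?thesis using True vw image_L reflD(6)[of v w] by (simp add: coloured_edges_def hv)
    next
      case False
      have "(\<phi> v, \<phi> w) \<in> E \<longleftrightarrow> (v, w) \<in> E"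
        using reflD(6)[of v w] reflD(6)[of "\<phi> v" "\<phi> w"] reflD(2) vw by auto
      then show ?thesis using False vw image_L by (auto simp: coloured_edges_def)
    qed
    have sub: "side D c' \<subseteq> V \<times> V" for D c' using EV by (auto simp: coloured_edges_def)
    show ?thesis
    proof (intro subset_antisym subsetI)
      fix e assume e: "e \<in> side (\<phi> ` L) (c \<circ> ?h)"
      obtain v w where vw: "e = (v, w)" by force
      have "v \<in> V" "w \<in> V" using e vw sub by blast+
      then show "e \<in> map_prod \<phi> \<phi> ` side L c"
        using e eq[of v w] reflD(2) vw by (intro image_eqI[of _ _ "(\<phi> v, \<phi> w)"]) auto
    next
      fix e assume "e \<in> map_prod \<phi> \<phi> ` side L c"
      then obtain v w where vw: "e = (\<phi> v, \<phi> w)" "(v, w) \<in> side L c" by force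
      then have "v \<in> V" "w \<in> V" using sub by blast+
      then show "e \<in> side (\<phi> ` L) (c \<circ> ?h)"
        using vw eq[of "\<phi> v" "\<phi> w"] reflD(1,2) by auto
    qed
  qed
  have "side_density mirror_verts (\<phi> ` L) (map_prod \<phi> \<phi> ` side L c) x =
      side_density mirror_verts L (side L c) x"
    if "x \<in> space (PiM mirror_verts (\<lambda>_. Z))" for x
  proof (rule side_density_reindex)
    show "bij_betw \<phi> L (\<phi> ` L)"
      using reflD(2,3) by (intro inj_on_imp_bij_betw inj_on_inverseI[of _ \<phi>]) auto
    show "finite (\<phi> ` L)" using fin reflD(3) finite_subset by blast
    show "mirror_verts \<inter> L = {}" "mirror_verts \<inter> \<phi> ` L = {}"
      by (rule parts_disjoint)+
  qed (use that side_subset in auto)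
  then show ?thesis
    unfolding hom_density_fold_split core sideL sideR by (intro nn_integral_cong) simp
qed

end

text \<open>Conditioning on the mirror writes the density as an integral of a b c; the two folded
  densities are the integrals of a b b and a c c. The comparison is with a sum rather than with a
  product as in Cauchy-Schwarz, because a maximal value below the mean of two others forces both to
  be maximal.\<close>

lemma hom_density_fold:
  assumes fin: "finite V" and EV: "E \<subseteq> V \<times> V" and refl: "reflects V E \<phi> L"
  shows "2 * hom_density V (coloured_edges Q E c) \<le>
    hom_density V (coloured_edges Q E (c \<circ> left_folding_map \<phi> L)) +
    hom_density V (coloured_edges Q E (c \<circ> left_folding_map \<phi> (\<phi> ` L)))"
proof -
  let ?X = "{v \<in> V. \<phi> v = v}" and ?P = "PiM {v \<in> V. \<phi> v = v} (\<lambda>_. Z)"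
  let ?side = "\<lambda>D. {(v, w) \<in> coloured_edges Q E c. v \<in> D \<or> w \<in> D}"
  let ?a = "\<lambda>x. \<Prod>(v, w)\<in>coloured_edges Q E c \<inter> ?X \<times> ?X. k (x v) (x w)"
  let ?b = "\<lambda>D. side_density ?X D (?side D)"
  have refl': "reflects V E \<phi> (\<phi> ` L)" by (rule reflects_swap[OF refl EV])
  have am: "?a \<in> borel_measurable ?P"
    by (rule hom_density_measurable) auto
  have LV: "L \<subseteq> V" "\<phi> ` L \<subseteq> V" using refl refl' unfolding reflects_def by auto
  have [measurable]: "?b L \<in> borel_measurable ?P"
    by (rule side_density_measurable[OF finite_subset[OF LV(1) fin] side_subset[OF fin EV refl]])
  have [measurable]: "?b (\<phi> ` L) \<in> borel_measurable ?P"
    by (rule side_density_measurable[OF finite_subset[OF LV(2) fin] side_subset[OF fin EV refl']])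
  note am[measurable]
  have "2 * hom_density V (coloured_edges Q E c) =
      2 * (\<integral>\<^sup>+ x. ?a x * (?b L x * ?b (\<phi> ` L) x) \<partial>?P)"
    by (simp only: hom_density_fold_split[OF fin EV refl])
  also have "\<dots> = (\<integral>\<^sup>+ x. 2 * (?a x * (?b L x * ?b (\<phi> ` L) x)) \<partial>?P)"
    by (rule nn_integral_cmult[symmetric]) measurable
  also have "\<dots> \<le> (\<integral>\<^sup>+ x. ?a x * (?b L x * ?b L x) + ?a x * (?b (\<phi> ` L) x * ?b (\<phi> ` L) x) \<partial>?P)"
  proof (rule nn_integral_mono)
    fix x
    have "?a x * (2 * (?b L x * ?b (\<phi> ` L) x)) \<le>
        ?a x * (?b L x * ?b L x + ?b (\<phi> ` L) x * ?b (\<phi> ` L) x)"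
      by (rule mult_left_mono[OF ennreal_two_mult_le_squares]) simp
    then show "2 * (?a x * (?b L x * ?b (\<phi> ` L) x)) \<le>
        ?a x * (?b L x * ?b L x) + ?a x * (?b (\<phi> ` L) x * ?b (\<phi> ` L) x)"
      by (simp only: mult.left_commute distrib_left)
  qed
  also have "\<dots> = (\<integral>\<^sup>+ x. ?a x * (?b L x * ?b L x) \<partial>?P) +
      (\<integral>\<^sup>+ x. ?a x * (?b (\<phi> ` L) x * ?b (\<phi> ` L) x) \<partial>?P)"
    by (rule nn_integral_add) measurable
  finally show ?thesis
    by (simp only: hom_density_folded[OF fin EV refl] hom_density_folded[OF fin EV refl'])
qed

end

section \<open>Finiteness, pendant edges and maximal colourings\<close>

context kernel begin

lemma hom_density_empty: "hom_density V {} = 1"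
proof -
  have "prob_space (PiM V (\<lambda>_. Z))" by (intro prob_space_PiM prob_space_base)
  then show ?thesis by (simp add: hom_density_def prob_space.emeasure_space_1)
qed

text \<open>Boundedness of the kernel bounds the edge product by a constant, and the measure is a
  probability measure. Finiteness permits cancellation in the maximality argument and the return to
  real densities.\<close>

lemma hom_density_finite:
  assumes "finite F" "F \<subseteq> V \<times> V" and B: "B < \<top>" "\<And>x y. x \<in> space Z \<Longrightarrow> y \<in> space Z \<Longrightarrow> k x y \<le> B"
  shows "hom_density V F < \<top>"
proof -
  have "\<exists>C<\<top>. \<forall>z\<in>space (PiM V (\<lambda>_. Z)). (\<Prod>(v, w)\<in>F. k (z v) (z w)) \<le> C"
    using assms(1,2)
  proof (induction F)
    case empty
    then show ?case by (intro exI[of _ 1]) simp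
  next
    case (insert e F)
    obtain v w where e: "e = (v, w)" by force
    obtain C where C: "C < \<top>" "\<forall>z\<in>space (PiM V (\<lambda>_. Z)). (\<Prod>(v, w)\<in>F. k (z v) (z w)) \<le> C"
      using insert by auto
    have "k (z v) (z w) * (\<Prod>(v, w)\<in>F. k (z v) (z w)) \<le> B * C" if "z \<in> space (PiM V (\<lambda>_. Z))" for z
      using insert.prems e C(2) that by (intro mult_mono B) (auto simp: space_PiM)
    moreover have "B * C < \<top>" using B C by (simp add: ennreal_mult_less_top)
    ultimately show ?case using insert.hyps e by (intro exI[of _ "B * C"]) simp
  qed
  then obtain C where C: "C < \<top>" "\<And>z. z \<in> space (PiM V (\<lambda>_. Z)) \<Longrightarrow> (\<Prod>(v, w)\<in>F. k (z v) (z w)) \<le> C"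
    by blast
  have "prob_space (PiM V (\<lambda>_. Z))" by (intro prob_space_PiM prob_space_base)
  moreover have "hom_density V F \<le> (\<integral>\<^sup>+ z. C \<partial>PiM V (\<lambda>_. Z))"
    unfolding hom_density_def by (intro nn_integral_mono C)
  ultimately show ?thesis
    using C(1) by (simp add: prob_space.emeasure_space_1)
qed

text \<open>The variable at \<open>w\<close> occurs in the factor of \<open>(u, w)\<close> only.
  Integrating it out first leaves the integral of \<open>k (x u)\<close>, which is 1 for almost
  every \<open>x\<close> because the coordinate at \<open>u\<close> is distributed as
  \<open>Z\<close>.\<close>

lemma hom_density_pendant:
  assumes fin: "finite V" and F: "F \<subseteq> (V - {w}) \<times> (V - {w})" and uw: "u \<in> V" "w \<in> V" "u \<noteq> w"
    and reg: "AE x in Z. (\<integral>\<^sup>+ y. k x y \<partial>Z) = 1"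
  shows "hom_density V (insert (u, w) F) = hom_density V F"
proof -
  let ?V = "V - {w}"
  let ?P = "PiM ?V (\<lambda>_. Z)" and ?f = "\<lambda>F z. \<Prod>(v, w)\<in>F. k (z v) (z w)"
  have V: "V = insert w ?V" using uw by auto
  have finF: "finite F" using F fin by (auto intro: finite_subset)
  have notin: "(u, w) \<notin> F" using F by auto
  have fm: "?f F' \<in> borel_measurable (PiM (insert w ?V) (\<lambda>_. Z))" if "F' \<subseteq> V \<times> V" for F'
    using hom_density_measurable[OF that] V by metis
  have upd: "?f F (x(w := y)) = ?f F x" for x y
    using F by (intro prod.cong) auto
  have upd_insert: "?f (insert (u, w) F) (x(w := y)) = k (x u) y * ?f F x" for x y
    using uw by (simp only: prod.insert[OF finF notin] upd) simp
  have int: "hom_density V F' = (\<integral>\<^sup>+ x. (\<integral>\<^sup>+ y. ?f F' (x(w := y)) \<partial>Z) \<partial>?P)" if "F' \<subseteq> V \<times> V" for F'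
    unfolding hom_density_def
    using product_nn_integral_insert[OF _ _ fm[OF that]] fin V by simp
  have AE: "AE x in ?P. (\<integral>\<^sup>+ y. k (x u) y \<partial>Z) = 1"
    by (rule AE_PiM_component[where P = "\<lambda>x. (\<integral>\<^sup>+ y. k x y \<partial>Z) = 1"])
      (use uw reg prob_space_base in auto)
  have "hom_density V (insert (u, w) F) = (\<integral>\<^sup>+ x. (\<integral>\<^sup>+ y. k (x u) y * ?f F x \<partial>Z) \<partial>?P)"
  proof -
    have FV: "insert (u, w) F \<subseteq> V \<times> V" using F uw by auto
    show ?thesis unfolding int[OF FV] upd_insert ..
  qed
  also have "\<dots> = (\<integral>\<^sup>+ x. ?f F x \<partial>?P)"
  proof (rule nn_integral_cong_AE)
    show "AE x in ?P. (\<integral>\<^sup>+ y. k (x u) y * ?f F x \<partial>Z) = ?f F x"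
      using AE AE_space
    proof eventually_elim
      case (elim x)
      have "x u \<in> space Z" using elim(2) uw by (auto simp: space_PiM)
      then have "k (x u) \<in> borel_measurable Z" by simp
      then show ?case using elim(1) by (simp add: nn_integral_multc)
    qed
  qed
  also have "\<dots> = hom_density V F"
  proof -
    have FV: "F \<subseteq> V \<times> V" using F by auto
    show ?thesis
      unfolding int[OF FV] upd by (simp add: prob_space.emeasure_space_1[OF prob_space_base])
  qed
  finally show ?thesis .
qed

lemma hom_density_pendant_star:
  assumes fin: "finite V" and S: "S \<subseteq> V" "u \<in> V" "u \<notin> S" and F: "F \<subseteq> (V - S) \<times> (V - S)"
    and reg: "AE x in Z. (\<integral>\<^sup>+ y. k x y \<partial>Z) = 1"
  shows "hom_density V (F \<union> {u} \<times> S) = hom_density V F"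
proof -
  have "finite S" using S fin finite_subset by blast
  then show ?thesis using S F
  proof (induction S)
    case (insert w S)
    have "hom_density V (insert (u, w) (F \<union> {u} \<times> S)) = hom_density V (F \<union> {u} \<times> S)"
      by (rule hom_density_pendant) (use insert fin reg in auto)
    then show ?case using insert by (simp add: subset_iff)
  qed simp
qed

text \<open>Both pullbacks are at most the maximum while their mean is at least the maximum, so both
  attain it. The passage to real numbers is where finiteness is used.\<close>

lemma hom_density_fold_max:
  assumes G: "is_bigraph G" and fold: "is_fold G \<phi> L"
    and fin: "hom_density (verts G) (coloured_edges Q (edges G) c) < \<top>"
    and max: "\<And>c'. hom_density (verts G) (coloured_edges Q (edges G) c') \<le>
       hom_density (verts G) (coloured_edges Q (edges G) c)"
  shows "hom_density (verts G) (coloured_edges Q (edges G) (c \<circ> left_folding_map \<phi> L)) =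
       hom_density (verts G) (coloured_edges Q (edges G) c)"
    and "hom_density (verts G) (coloured_edges Q (edges G) (c \<circ> left_folding_map \<phi> (\<phi> ` L))) =
       hom_density (verts G) (coloured_edges Q (edges G) c)"
proof -
  let ?t = "\<lambda>c. hom_density (verts G) (coloured_edges Q (edges G) c)"
  let ?c1 = "c \<circ> left_folding_map \<phi> L" and ?c2 = "c \<circ> left_folding_map \<phi> (\<phi> ` L)"
  have le: "2 * ?t c \<le> ?t ?c1 + ?t ?c2"
    by (rule hom_density_fold[OF _ _ fold_reflects[OF G fold]])
      (use G in \<open>auto simp: is_bigraph_def verts_def\<close>)
  obtain m where m: "?t c = ennreal m" "0 \<le> m"
    using fin by (cases "?t c") auto
  have "?t c' < \<top>" for c' using max[of c'] fin by (rule le_less_trans)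
  then obtain m1 m2 where m12: "?t ?c1 = ennreal m1" "0 \<le> m1" "?t ?c2 = ennreal m2" "0 \<le> m2"
    by (metis ennreal_cases less_irrefl top.not_eq_extremum)
  have "m1 \<le> m" "m2 \<le> m" using max[of ?c1] max[of ?c2] m m12 by auto
  moreover have "ennreal (2 * m) \<le> ennreal (m1 + m2)"
    using le m m12 by (simp add: ennreal_mult ennreal_plus)
  then have "2 * m \<le> m1 + m2" using m12 by (subst (asm) ennreal_le_iff) auto
  ultimately show "?t ?c1 = ?t c" "?t ?c2 = ?t c" using m m12 by auto
qed

text \<open>The edge set induced by \<open>U\<close> comes from the colouring by the indicator of
  \<open>U\<close>, so it suffices that the full edge set comes from a colouring of maximal
  density.\<close>

lemma hom_density_induced_le:
  fixes G :: "'v bigraph"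
  assumes G: "is_bigraph G" and lcp: "left_cut_percolating G"
    and B: "B < \<top>" "\<And>x y. x \<in> space Z \<Longrightarrow> y \<in> space Z \<Longrightarrow> k x y \<le> B"
    and reg: "AE x in Z. (\<integral>\<^sup>+ y. k x y \<partial>Z) = 1"
  shows "hom_density (verts G) (edges G \<inter> U \<times> U) \<le> hom_density (verts G) (edges G)"
    and "hom_density (verts G) (edges G) < \<top>"
proof -
  let ?V = "verts G" and ?E = "edges G"
  have finV: "finite ?V" and EV: "?E \<subseteq> ?V \<times> ?V" and E: "?E \<subseteq> lverts G \<times> rverts G"
    and lr: "lverts G \<inter> rverts G = {}"
    using G unfolding is_bigraph_def verts_def by auto
  have finE: "finite ?E" using finV EV by (auto intro: finite_subset)
  \<comment> \<open>Colours 0 and 1 suffice to describe induced edge sets. Colour 2 acts on the left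
    only, so that a constant left colouring by 2 selects all edges whatever the right colours
    are.\<close>
  define Q :: "nat \<Rightarrow> nat \<Rightarrow> bool" where "Q i j \<longleftrightarrow> i = 2 \<or> i = 1 \<and> j = 1" for i j
  let ?F = "coloured_edges Q ?E" and ?t = "\<lambda>c. hom_density ?V (coloured_edges Q ?E c)"
  have lt: "hom_density ?V F < \<top>" if "F \<subseteq> ?E" for F
    using that EV finite_subset[OF that finE] B by (intro hom_density_finite) auto
  \<comment> \<open>There may be infinitely many colourings, but they select subsets of a finite
    edge set, so a maximal density is attained.\<close>
  have "range ?t \<subseteq> hom_density ?V ` Pow ?E"
    by (rule image_subsetI) (rule imageI, rule PowI, rule coloured_edges_subset)
  then have fin: "finite (range ?t)"
    by (rule finite_subset) (simp add: finE)
  define P where "P c \<longleftrightarrow> ?t c = Max (range ?t)" for c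
  have max: "?t c' \<le> ?t c" if "P c" for c c'
    unfolding that[unfolded P_def] by (rule Max_ge[OF fin]) simp
  have "Max (range ?t) \<in> range ?t" by (rule Max_in[OF fin]) simp
  then obtain c where c: "P c" unfolding P_def by (metis rangeE)
  have step: "P (c \<circ> left_folding_map \<phi> L) \<and> P (c \<circ> left_folding_map \<phi> (\<phi> ` L))"
    if "P c" "is_fold G \<phi> L" for c \<phi> L
    using hom_density_fold_max[OF G that(2) lt[OF coloured_edges_subset] max[OF that(1)]] that(1)
    unfolding P_def by simp
  have full: "\<exists>c'. P c' \<and> (\<forall>v\<in>lverts G. c' v = c v0)" if "P c" "v0 \<in> lverts G" for c v0
    by (rule percolation[where P = P, OF lcp that(2,1) step]) blast+
  \<comment> \<open>\<open>full\<close> can start at any left vertex; the singleton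
    \<open>U 0\<close> shows that there is one.\<close>
  obtain u where u: "u \<in> lverts G"
  proof -
    obtain m and U :: "nat \<Rightarrow> 'v set" where "\<forall>i\<in>{0..m}. U i \<subseteq> lverts G" "card (U 0) = 1"
      using lcp unfolding left_cut_percolating_def by blast
    then have "U 0 \<subseteq> lverts G" "card (U 0) = 1" by auto
    then show ?thesis using that by (metis card_1_singletonE insert_subset)
  qed
  have uV: "u \<in> ?V" using u by (simp add: verts_def)
  have two: "\<exists>c'. P c' \<and> (\<forall>v\<in>lverts G. c' v = 2)"
  proof -
    have one: ?thesis if d: "P d" "\<forall>v\<in>lverts G. d v = 1" for d
    proof -
      \<comment> \<open>With every left vertex coloured 1, the right vertices of other colours meet
        no selected edge. The edges gained by giving \<open>u\<close> colour 2 therefore end in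
        isolated vertices and leave the density unchanged.\<close>
      let ?S = "{w \<in> rverts G. (u, w) \<in> ?E \<and> d w \<noteq> 1}"
      have "?F (d(u := 2)) = ?F d \<union> {u} \<times> ?S"
        using E lr u d(2) unfolding coloured_edges_def Q_def by auto
      moreover have "hom_density ?V (?F d \<union> {u} \<times> ?S) = ?t d"
      proof (rule hom_density_pendant_star[OF finV _ uV _ _ reg])
        show "?F d \<subseteq> (?V - ?S) \<times> (?V - ?S)"
          using E EV lr d(2) unfolding coloured_edges_def Q_def by auto
      qed (use u lr in \<open>auto simp: verts_def\<close>)
      ultimately have "P (d(u := 2))" using d(1) unfolding P_def by simp
      from full[OF this u] show ?thesis by simp
    qed
    show ?thesis
    proof (cases "\<exists>v\<in>lverts G. c v = 2 \<or> c v = 1")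
      case True
      then show ?thesis using full[OF c] one by fastforce
    next
      case False
      \<comment> \<open>Without colours 1 and 2 on the left no edge is selected. The colouring
        \<open>?d\<close> also selects none, as its right colours are 0, so it is maximal too and
        falls under \<open>one\<close>.\<close>
      let ?d = "\<lambda>v. if v \<in> lverts G then 1 else (0::nat)"
      have "?F c = ?F ?d"
        using False E lr unfolding coloured_edges_def Q_def by auto
      then have "P ?d" using c unfolding P_def by simp
      then show ?thesis by (intro one) auto
    qed
  qed
  then obtain c2 where c2: "P c2" "\<forall>v\<in>lverts G. c2 v = 2" by blast
  have "?F c2 = ?E" using c2(2) E by (auto simp: coloured_edges_def Q_def)
  moreover have "?F (\<lambda>v. if v \<in> U then 1 else 0) = ?E \<inter> U \<times> U"
    by (auto simp: coloured_edges_def Q_def)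
  ultimately show "hom_density ?V (?E \<inter> U \<times> U) \<le> hom_density ?V ?E"
    using max[OF c2(1), of "\<lambda>v. if v \<in> U then 1 else 0"] by simp
  show "hom_density ?V ?E < \<top>" by (rule lt) simp
qed

end

subsection \<open>Bigraphons as kernels\<close>

text \<open>Images of independent variables are independent, which is checked on rectangles. Taking
  a projection of a pair for \<open>h\<close> discards the spare coordinate at each vertex, and
  \<open>J\<close> discards spare vertices.\<close>

lemma distr_PiM_map_components:
  assumes Z: "prob_space Z" and M: "prob_space M" and h: "h \<in> Z \<rightarrow>\<^sub>M M" "distr Z M h = M"
    and J: "finite J" "J \<subseteq> I"
  shows "distr (PiM I (\<lambda>_. Z)) (PiM J (\<lambda>_. M)) (\<lambda>z. \<lambda>v\<in>J. h (z v)) = PiM J (\<lambda>_. M)"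
proof -
  interpret Z: prob_space Z by (rule Z)
  interpret M: prob_space M by (rule M)
  interpret PZ: product_prob_space "\<lambda>_. Z" I by standard
  interpret PM: product_prob_space "\<lambda>_. M" J by standard
  note h(1)[measurable]
  have m: "(\<lambda>z. \<lambda>v\<in>J. h (z v)) \<in> PiM I (\<lambda>_. Z) \<rightarrow>\<^sub>M PiM J (\<lambda>_. M)"
    using J by (intro measurable_restrict measurable_compose[OF _ h(1)] measurable_component_singleton) auto
  show ?thesis
  proof (rule PM.PiM_eqI)
    fix A assume A: "\<And>i. i \<in> J \<Longrightarrow> A i \<in> sets M"
    have "(\<lambda>z. \<lambda>v\<in>J. h (z v)) -` Pi\<^sub>E J A \<inter> space (PiM I (\<lambda>_. Z)) =
        {z \<in> space (PiM I (\<lambda>_. Z)). \<forall>v\<in>J. z v \<in> h -` A v \<inter> space Z}"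
      using J(2) by (auto simp: space_PiM restrict_PiE_iff PiE_mem)
    moreover have "emeasure (PiM I (\<lambda>_. Z)) {z \<in> space (PiM I (\<lambda>_. Z)). \<forall>v\<in>J. z v \<in> h -` A v \<inter> space Z}
        = (\<Prod>v\<in>J. emeasure Z (h -` A v \<inter> space Z))"
      using J A h(1) by (intro PZ.emeasure_PiM_Collect) auto
    moreover have "emeasure Z (h -` A v \<inter> space Z) = emeasure M (A v)" if "v \<in> J" for v
      using emeasure_distr[OF h(1) A[OF that]] h(2) by simp
    ultimately show "emeasure (distr (PiM I (\<lambda>_. Z)) (PiM J (\<lambda>_. M)) (\<lambda>z. \<lambda>v\<in>J. h (z v))) (Pi\<^sub>E J A) =
        (\<Prod>v\<in>J. emeasure M (A v))"
      using A J by (subst emeasure_distr[OF m]) (auto intro: sets_PiM_I_finite)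
  qed (use J in auto)
qed

lemma distr_fst_pair:
  assumes "prob_space M" "prob_space N"
  shows "distr (M \<Otimes>\<^sub>M N) M fst = M"
proof (rule measure_eqI)
  interpret M: prob_space M by fact
  interpret N: prob_space N by fact
  fix A assume "A \<in> sets (distr (M \<Otimes>\<^sub>M N) M fst)"
  then have A: "A \<in> sets M" by simp
  then have "fst -` A \<inter> space (M \<Otimes>\<^sub>M N) = A \<times> space N"
    using sets.sets_into_space by (auto simp: space_pair_measure)
  then show "emeasure (distr (M \<Otimes>\<^sub>M N) M fst) A = emeasure M A"
    using A by (simp add: emeasure_distr N.emeasure_pair_measure_Times N.emeasure_space_1)
qed simp

lemma distr_snd_pair:
  assumes "prob_space M" "prob_space N"
  shows "distr (M \<Otimes>\<^sub>M N) N snd = N"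
proof (rule measure_eqI)
  interpret M: prob_space M by fact
  interpret N: prob_space N by fact
  fix A assume "A \<in> sets (distr (M \<Otimes>\<^sub>M N) N snd)"
  then have A: "A \<in> sets N" by simp
  then have "snd -` A \<inter> space (M \<Otimes>\<^sub>M N) = space M \<times> A"
    using sets.sets_into_space by (auto simp: space_pair_measure)
  then show "emeasure (distr (M \<Otimes>\<^sub>M N) N snd) A = emeasure N A"
    using A by (simp add: emeasure_distr N.emeasure_pair_measure_Times M.emeasure_space_1)
qed simp

text \<open>Each vertex carries a pair of which the integrand reads one coordinate, the first on
  \<open>l\<close> and the second on \<open>r\<close>; the coordinates left unread integrate to
  1.\<close>

lemma nn_integral_bipartite:
  assumes M: "prob_space M" and N: "prob_space N"
    and fin: "finite V" and lr: "l \<inter> r = {}" "l \<subseteq> V" "r \<subseteq> V"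
    and g: "g \<in> borel_measurable (PiM l (\<lambda>_. M) \<Otimes>\<^sub>M PiM r (\<lambda>_. N))"
  shows "integral\<^sup>N (PiM l (\<lambda>_. M) \<Otimes>\<^sub>M PiM r (\<lambda>_. N)) g =
    (\<integral>\<^sup>+ z. g (\<lambda>v\<in>l. fst (z v), \<lambda>w\<in>r. snd (z w)) \<partial>PiM V (\<lambda>_. M \<Otimes>\<^sub>M N))"
proof -
  let ?Z = "M \<Otimes>\<^sub>M N" and ?P = "\<lambda>I. PiM I (\<lambda>_. M \<Otimes>\<^sub>M N)"
  let ?L = "PiM l (\<lambda>_. M)" and ?R = "PiM r (\<lambda>_. N)"
  let ?p = "\<lambda>z. \<lambda>v\<in>l. fst (z v)" and ?q = "\<lambda>z. \<lambda>w\<in>r. snd (z w)"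
  interpret M: prob_space M by fact
  interpret N: prob_space N by fact
  interpret MN: pair_prob_space M N ..
  interpret PZ: product_prob_space "\<lambda>_. ?Z" V by standard
  have Z: "prob_space ?Z" by unfold_locales
  have R: "sigma_finite_measure ?R"
    by (intro prob_space_imp_sigma_finite prob_space_PiM N)
  \<comment> \<open>Vertices of \<open>V\<close> in neither part are kept together with
    \<open>r\<close> and vanish in the projection \<open>?q\<close>.\<close>
  let ?V = "V - l"
  have V: "V = l \<union> ?V" using lr by auto
  have finl: "finite l" "finite r" using lr fin by (auto intro: finite_subset)
  have dp: "distr (?P l) ?L ?p = ?L"
    by (rule distr_PiM_map_components[OF Z M measurable_fst distr_fst_pair[OF M N] finl(1)]) simp
  have dq: "distr (?P ?V) ?R ?q = ?R"
    by (rule distr_PiM_map_components[OF Z N measurable_snd distr_snd_pair[OF M N] finl(2)])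
      (use lr in auto)
  have pm: "?p \<in> ?P I \<rightarrow>\<^sub>M ?L" if "l \<subseteq> I" for I
    using that by (intro measurable_restrict) auto
  have qm: "?q \<in> ?P I \<rightarrow>\<^sub>M ?R" if "r \<subseteq> I" for I
    using that by (intro measurable_restrict) auto
  have gm: "(\<lambda>z. g (?p z, ?q z)) \<in> borel_measurable (?P (l \<union> ?V))"
    by (rule measurable_compose[OF measurable_Pair[OF pm qm] g]) (use lr in auto)
  have gx: "(\<lambda>b. g (a, b)) \<in> borel_measurable ?R" if "a \<in> space ?L" for a
    using measurable_compose[OF measurable_Pair1'[OF that] g] .
  have inner: "(\<integral>\<^sup>+ y. g (?p (merge l ?V (x, y)), ?q (merge l ?V (x, y))) \<partial>?P ?V) =
      (\<integral>\<^sup>+ b. g (?p x, b) \<partial>?R)" if x: "x \<in> space (?P l)" for x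
  proof -
    have "?p (merge l ?V (x, y)) = ?p x" "?q (merge l ?V (x, y)) = ?q y" for y
      using lr by (auto simp: merge_def fun_eq_iff restrict_def)
    then have "(\<integral>\<^sup>+ y. g (?p (merge l ?V (x, y)), ?q (merge l ?V (x, y))) \<partial>?P ?V) =
        (\<integral>\<^sup>+ y. g (?p x, ?q y) \<partial>?P ?V)" by simp
    also have "\<dots> = (\<integral>\<^sup>+ b. g (?p x, b) \<partial>distr (?P ?V) ?R ?q)"
    proof (rule nn_integral_distr[symmetric])
      show "?q \<in> ?P ?V \<rightarrow>\<^sub>M ?R" using lr by (intro qm) auto
      show "(\<lambda>b. g (?p x, b)) \<in> borel_measurable (distr (?P ?V) ?R ?q)"
        using gx[OF measurable_space[OF pm x]] by simp
    qed
    finally show ?thesis by (simp only: dq)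
  qed
  have "(\<integral>\<^sup>+ z. g (?p z, ?q z) \<partial>?P V) = (\<integral>\<^sup>+ z. g (?p z, ?q z) \<partial>?P (l \<union> ?V))"
    using V by simp
  also have "\<dots> = (\<integral>\<^sup>+ x. (\<integral>\<^sup>+ b. g (?p x, b) \<partial>?R) \<partial>?P l)"
    using fin finl by (subst PZ.product_nn_integral_fold[OF _ _ _ gm]) (auto intro!: nn_integral_cong inner)
  also have "\<dots> = (\<integral>\<^sup>+ a. (\<integral>\<^sup>+ b. g (a, b) \<partial>?R) \<partial>distr (?P l) ?L ?p)"
  proof (rule nn_integral_distr[symmetric])
    show "?p \<in> ?P l \<rightarrow>\<^sub>M ?L" by (rule pm) simp
    show "(\<lambda>a. \<integral>\<^sup>+ b. g (a, b) \<partial>?R) \<in> borel_measurable (distr (?P l) ?L ?p)"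
      using sigma_finite_measure.borel_measurable_nn_integral_fst[OF R g] by simp
  qed
  also have "\<dots> = (\<integral>\<^sup>+ a. (\<integral>\<^sup>+ b. g (a, b) \<partial>?R) \<partial>?L)" by (simp only: dp)
  also have "\<dots> = integral\<^sup>N (?L \<Otimes>\<^sub>M ?R) g"
    by (rule sigma_finite_measure.nn_integral_fst[OF R g])
  finally show ?thesis by simp
qed

text \<open>The power of \<open>p\<close> is distributed over the edges, one factor to each.
  Allowing \<open>V\<close> to exceed the vertices of \<open>H\<close> lets a graph and its induced
  subgraphs be compared over the same product space.\<close>

lemma density_in_eq_hom_density:
  assumes W: "bigraphon M N W" and H: "is_bigraph H" and V: "finite V" "verts H \<subseteq> V" and p: "0 < p"
    and Z: "kernel (M \<Otimes>\<^sub>M N) (\<lambda>z z'. ennreal (W (fst z) (snd z') / p))"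
  shows "density_in H M N W / p ^ card (edges H) =
    enn2real (kernel.hom_density (M \<Otimes>\<^sub>M N) (\<lambda>z z'. ennreal (W (fst z) (snd z') / p)) V (edges H))"
proof -
  let ?Q = "PiM (lverts H) (\<lambda>_. M) \<Otimes>\<^sub>M PiM (rverts H) (\<lambda>_. N)"
  let ?f = "\<lambda>q. \<Prod>(v, w)\<in>edges H. W (fst q v) (snd q w) / p"
  have M: "prob_space M" and N: "prob_space N"
    and Wm [measurable]: "case_prod W \<in> borel_measurable (M \<Otimes>\<^sub>M N)"
    and nonneg: "\<And>x y. x \<in> space M \<Longrightarrow> y \<in> space N \<Longrightarrow> 0 \<le> W x y"
    using W unfolding bigraphon_def by auto
  have E: "edges H \<subseteq> lverts H \<times> rverts H" and lr: "lverts H \<inter> rverts H = {}"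
    using H unfolding is_bigraph_def by auto
  have fm: "?f \<in> borel_measurable ?Q"
  proof (rule borel_measurable_prod)
    fix e assume e: "e \<in> edges H"
    obtain v w where vw: "e = (v, w)" by force
    have [measurable]: "(\<lambda>q. fst q v) \<in> ?Q \<rightarrow>\<^sub>M M" "(\<lambda>q. snd q w) \<in> ?Q \<rightarrow>\<^sub>M N"
      using e E vw by auto
    show "(\<lambda>q. case e of (v, w) \<Rightarrow> W (fst q v) (snd q w) / p) \<in> borel_measurable ?Q"
      unfolding vw by simp
  qed
  have f0: "0 \<le> W (fst q v) (snd q w) / p" if "q \<in> space ?Q" "(v, w) \<in> edges H" for q v w
    using that E p by (auto simp: space_pair_measure space_PiM intro!: divide_nonneg_pos nonneg)
  have "density_in H M N W / p ^ card (edges H) = integral\<^sup>L ?Q ?f"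
    unfolding density_in_def
    by (simp add: prod_dividef case_prod_unfold flip: integral_divide_zero)
  also have "\<dots> = enn2real (\<integral>\<^sup>+ q. ennreal (?f q) \<partial>?Q)"
    by (rule integral_eq_nn_integral[OF fm]) (auto intro!: AE_I2 prod_nonneg f0)
  also have "(\<integral>\<^sup>+ q. ennreal (?f q) \<partial>?Q) =
      (\<integral>\<^sup>+ z. ennreal (?f (\<lambda>v\<in>lverts H. fst (z v), \<lambda>w\<in>rverts H. snd (z w))) \<partial>PiM V (\<lambda>_. M \<Otimes>\<^sub>M N))"
    by (rule nn_integral_bipartite[OF M N V(1) lr]) (use V fm in \<open>auto simp: verts_def\<close>)
  also have "\<dots> = kernel.hom_density (M \<Otimes>\<^sub>M N) (\<lambda>z z'. ennreal (W (fst z) (snd z') / p)) V (edges H)"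
    unfolding kernel.hom_density_def[OF Z]
  proof (rule nn_integral_cong)
    fix z assume z: "z \<in> space (PiM V (\<lambda>_. M \<Otimes>\<^sub>M N))"
    have "z v \<in> space M \<times> space N" if "v \<in> V" for v
      using z that by (auto simp: space_PiM space_pair_measure)
    then have "0 \<le> W (fst (z v)) (snd (z w)) / p" if "(v, w) \<in> edges H" for v w
      using that E V p by (intro divide_nonneg_pos nonneg) (auto simp: verts_def mem_Times_iff)
    moreover have "?f (\<lambda>v\<in>lverts H. fst (z v), \<lambda>w\<in>rverts H. snd (z w)) =
        (\<Prod>(v, w)\<in>edges H. W (fst (z v)) (snd (z w)) / p)"
      using E by (intro prod.cong) auto
    ultimately show "ennreal (?f (\<lambda>v\<in>lverts H. fst (z v), \<lambda>w\<in>rverts H. snd (z w))) =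
        (\<Prod>(v, w)\<in>edges H. ennreal (W (fst (z v)) (snd (z w)) / p))"
      by (simp add: case_prod_unfold prod_ennreal)
  qed
  finally show ?thesis .
qed

theorem theorem3p2:
  fixes G :: "'v bigraph"
  assumes "is_bigraph G"
    and "left_cut_percolating G"
  shows "induced_sidorenko TYPE('a) TYPE('b) G"
  unfolding induced_sidorenko_def weakly_dominates_def
proof (intro allI impI)
  fix U and M :: "'a measure" and N :: "'b measure" and W :: "'a \<Rightarrow> 'b \<Rightarrow> real"
  assume "U \<subseteq> verts G" and "bigraphon M N W \<and> biregular M N W \<and> nonzero M N W"
  then have W: "bigraphon M N W" and bireg: "biregular M N W" and nz: "nonzero M N W" by auto
  define p where "p = density_in edge_bigraph M N W"
  \<comment> \<open>Division by \<open>p\<close> turns regularity into total mass 1 in the second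
    argument, as required for removing pendant edges.\<close>
  define k where "k z z' = ennreal (W (fst z) (snd z') / p)" for z z' :: "'a \<times> 'b"
  obtain B where M: "prob_space M" and N: "prob_space N"
    and Wm [measurable]: "case_prod W \<in> borel_measurable (M \<Otimes>\<^sub>M N)"
    and nonneg: "\<And>x y. x \<in> space M \<Longrightarrow> y \<in> space N \<Longrightarrow> 0 \<le> W x y"
    and B: "\<And>x y. x \<in> space M \<Longrightarrow> y \<in> space N \<Longrightarrow> W x y \<le> B"
    using W unfolding bigraphon_def by blast
  interpret M: prob_space M by (rule M)
  interpret N: prob_space N by (rule N)
  interpret MN: pair_prob_space M N ..
  have reg: "AE x in M. (\<integral>y. W x y \<partial>N) = p"
    using bireg unfolding biregular_def p_def by simp
  have int: "integrable N (W x)" if "x \<in> space M" for x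
    using that nonneg B
    by (intro N.integrable_const_bound[where B = B] AE_I2) auto
  have p0: "0 \<le> p"
    unfolding p_def density_in_def edge_bigraph_def
    by (intro integral_nonneg_AE AE_I2)
      (auto simp: space_pair_measure space_PiM intro!: nonneg)
  \<comment> \<open>If \<open>p\<close> were 0, almost every section of the nonnegative
    \<open>W\<close> would have integral 0 and so vanish almost everywhere, contradicting that
    \<open>W\<close> is non-zero.\<close>
  have "p \<noteq> 0"
  proof
    assume p: "p = 0"
    have "AE x in M. AE y in N. W x y = 0"
      using reg AE_space
    proof eventually_elim
      case (elim x)
      then show ?case
        using integral_nonneg_eq_0_iff_AE[OF int[of x]] nonneg p by (auto intro!: AE_I2)
    qed
    then have "AE q in M \<Otimes>\<^sub>M N. W (fst q) (snd q) = 0"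
      by (intro MN.AE_pair_measure) (auto simp: case_prod_unfold[symmetric])
    then show False using nz unfolding nonzero_def by simp
  qed
  then have p: "0 < p" using p0 by simp
  interpret K: kernel "M \<Otimes>\<^sub>M N" k
  proof
    show "case_prod k \<in> borel_measurable ((M \<Otimes>\<^sub>M N) \<Otimes>\<^sub>M (M \<Otimes>\<^sub>M N))"
      unfolding k_def by simp
  qed
  have k: "k = (\<lambda>z z'. ennreal (W (fst z) (snd z') / p))"
    by (simp add: k_def fun_eq_iff)
  have ker: "kernel (M \<Otimes>\<^sub>M N) (\<lambda>z z'. ennreal (W (fst z) (snd z') / p))"
    using K.kernel_axioms unfolding k .
  have kB: "k z z' \<le> ennreal (B / p)" if "z \<in> space (M \<Otimes>\<^sub>M N)" "z' \<in> space (M \<Otimes>\<^sub>M N)" for z z'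
    using that p B unfolding k_def
    by (intro ennreal_leI divide_right_mono) (auto simp: space_pair_measure)
  \<comment> \<open>Regularity speaks of points of \<open>M\<close>, the kernel of pairs; the
    statement is pulled back along \<open>fst\<close>, whose image measure is
    \<open>M\<close>.\<close>
  have "AE x in distr (M \<Otimes>\<^sub>M N) M fst. (\<integral>y. W x y \<partial>N) = p"
    unfolding distr_fst_pair[OF M N] by (rule reg)
  then have "AE z in M \<Otimes>\<^sub>M N. (\<integral>y. W (fst z) y \<partial>N) = p"
    by (rule AE_distrD[rotated]) simp
  then have kreg: "AE z in M \<Otimes>\<^sub>M N. (\<integral>\<^sup>+ z'. k z z' \<partial>(M \<Otimes>\<^sub>M N)) = 1"
    using AE_space
  proof eventually_elim
    case (elim z)
    then have x: "fst z \<in> space M" by (auto simp: space_pair_measure)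
    then have [measurable]: "W (fst z) \<in> borel_measurable N" using int by auto
    have "(\<integral>\<^sup>+ z'. k z z' \<partial>(M \<Otimes>\<^sub>M N)) =
        (\<integral>\<^sup>+ y. ennreal (W (fst z) y / p) \<partial>distr (M \<Otimes>\<^sub>M N) N snd)"
      unfolding k_def by (rule nn_integral_distr[symmetric]) simp_all
    also have "\<dots> = (\<integral>\<^sup>+ y. ennreal (W (fst z) y / p) \<partial>N)"
      by (simp only: distr_snd_pair[OF M N])
    also have "\<dots> = ennreal (\<integral>y. W (fst z) y / p \<partial>N)"
      using int[OF x] nonneg[OF x] p by (intro nn_integral_eq_integral AE_I2) auto
    also have "\<dots> = 1" using elim(1) p by simp
    finally show ?case .
  qed
  have fin: "finite (verts G)"
    using assms(1) unfolding is_bigraph_def verts_def by simp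
  have ind: "is_bigraph (induced G U)" "verts (induced G U) \<subseteq> verts G"
    "edges (induced G U) = edges G \<inter> U \<times> U"
    using assms(1) unfolding is_bigraph_def induced_def verts_def by auto
  have "K.hom_density (verts G) (edges G \<inter> U \<times> U) \<le> K.hom_density (verts G) (edges G)"
    "K.hom_density (verts G) (edges G) < \<top>"
    by (rule K.hom_density_induced_le[OF assms _ kB kreg]; simp)+
  \<comment> \<open>\<open>enn2real\<close> sends infinity to 0, so monotonicity rests on finiteness
    of the larger side.\<close>
  then have "enn2real (K.hom_density (verts G) (edges (induced G U))) \<le>
      enn2real (K.hom_density (verts G) (edges G))"
    unfolding ind(3) by (rule enn2real_mono)
  then show "density_in (induced G U) M N W / density_in edge_bigraph M N W ^ card (edges (induced G U))
      \<le> density_in G M N W / density_in edge_bigraph M N W ^ card (edges G)"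
    using density_in_eq_hom_density[OF W assms(1) fin order_refl p ker]
      density_in_eq_hom_density[OF W ind(1) fin ind(2) p ker]
    unfolding p_def[symmetric] k by simp
qed

end
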